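(* Let $K$ be a field, let $H$ be a finite distributive lattice with unique minimal element $x_0$, let $P$ be the poset of join-irreducible elements of $H$ (with $x_0\in P$), and let $r=\operatorname{rank}P^+$. Let $d$ be an integer with $r\le d\le r_{\max}$. Then there exists a generator of the canonical module of the Hibi ring $\mathcal R_K(H)$ of degree $d$.
   Context: Join-irreducible elements: $P=\{\alpha\in H\mid \alpha=\beta\vee\gamma\Rightarrow\alpha=\beta\text{ or }\alpha=\gamma\}$ with the order induced from $H$; in particular the minimum $x_0$ of $H$ belongs to $P$ and is its unique minimal element. $P^+=P\cup\{\infty\}$ with $x<\infty$ for all $x\in P$. Rank: the length of a chain $X$ is $\#X-1$; the rank of a finite poset is the maximum length of its chains. For $x\le y$ in $P^+$, $[x,y]=\{z\in P^+\mid x\le z\le y\}$. Hibi ring: with indeterminates $T_x$ ($x\in P$), $\mathcal R_K(H)=K[\prod_{x\in P,\,x\le\alpha}T_x\mid\alpha\in H]$, graded by $\deg T_{x_0}=1$ and $\deg T_x=0$ for $x\in P\setminus\{x_0\}$. For $\nu:P\to\mathbb N$ (where $\mathbb N$ includes $0$) write $T^\nu=\prod_{x\in P}T_x^{\nu(x)}$. Then $\mathcal R_K(H)=\bigoplus_{\nu\in\overline{\mathcal T}(P)}KT^\nu$ with $\overline{\mathcal T}(P)=\{\nu:P\to\mathbb N\mid x\le y\Rightarrow\nu(x)\ge\nu(y)\}$, and its canonical module is $\bigoplus_{\nu\in\mathcal T(P)}KT^\nu$ with $\mathcal T(P)=\{\nu:P\to\mathbb N\mid \nu(z)>0\ \forall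 z\in P,\ x<y\Rightarrow\nu(x)>\nu(y)\}$, with $\deg T^\nu=\nu(x_0)$. A generator of the canonical module means a member of its minimal generating system consisting of monomials $T^\nu$ (this system is unique up to nonzero scalars). Condition N: a (possibly empty, $t=0$) sequence $y_1,x_1,y_2,x_2,\ldots,y_t,x_t$ of elements of $P$ satisfies condition N if (1) $x_1\ne x_0$; (2) $y_1>x_1<y_2>x_2<\cdots<y_t>x_t$; (3) $y_i\not\ge x_j$ whenever $1\le i<j\le t$. For such a sequence, $r(y_1,x_1,\ldots,y_t,x_t)=\sum_{i=1}^t(\operatorname{rank}[x_{i-1},y_i]-\operatorname{rank}[x_i,y_i])+\operatorname{rank}[x_t,\infty]$, where the term $x_{i-1}$ for $i=1$ is the minimal element $x_0$ of $P$; for the empty sequence the value is $r$. Finally $r_{\max}$ is the maximum of $r(y_1,x_1,\ldots,y_t,x_t)$ over all sequences with condition N (there are finitely many). *)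

theory Defs
  imports Main "HOL-Library.Poly_Mapping" "HOL-Library.Extended"
begin

section \<open>Finite posets\<close>

text \<open>Integer-valued, because differences of ranks may be negative.\<close>
definition poset_rank :: "'b::order set \<Rightarrow> int" where
  "poset_rank A = Max {int (card X) - 1 | X. X \<subseteq> A \<and> Complete_Partial_Order.chain (\<le>) X}"

text \<open>
  The lattice \<open>H\<close> is the whole type; its minimum \<open>x\<^sub>0\<close> is \<^term>\<open>bot\<close>, which counts as
  join-irreducible here.
\<close>
definition join_irreducibles :: "'a::lattice set" where
  "join_irreducibles = {a. \<forall>b c. a = sup b c \<longrightarrow> a = b \<or> a = c}"

text \<open>\<open>P\<^sup>+\<close>; the value \<^term>\<open>Minf\<close> of the type is not used.\<close>
definition plus_poset :: "'a set \<Rightarrow> 'a extended set" where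
  "plus_poset P = insert Pinf (Fin ` P)"

definition plus_interval :: "'a::order set \<Rightarrow> 'a extended \<Rightarrow> 'a extended \<Rightarrow> 'a extended set" where
  "plus_interval P x y = {z \<in> plus_poset P. x \<le> z \<and> z \<le> y}"

section \<open>Condition N\<close>

text \<open>
  A sequence \<open>y\<^sub>1, x\<^sub>1, \<dots>, y\<^sub>t, x\<^sub>t\<close> is given by its length \<open>t\<close> and two functions, of which only
  the values at \<open>1, \<dots>, t\<close> matter.
\<close>
definition condition_N ::
  "'a::order_bot set \<Rightarrow> nat \<Rightarrow> (nat \<Rightarrow> 'a) \<Rightarrow> (nat \<Rightarrow> 'a) \<Rightarrow> bool" where
  "condition_N P t y x \<longleftrightarrow>
     (\<forall>i\<in>{1..t}. y i \<in> P \<and> x i \<in> P) \<and>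
     (1 \<le> t \<longrightarrow> x 1 \<noteq> bot) \<and>
     (\<forall>i\<in>{1..t}. y i > x i) \<and> (\<forall>i\<in>{1..<t}. x i < y (i + 1)) \<and>
     (\<forall>i j. 1 \<le> i \<and> i < j \<and> j \<le> t \<longrightarrow> \<not> y i \<ge> x j)"

text \<open>The update \<open>x(0 := bot)\<close> implements the convention that \<open>x\<^sub>i\<^sub>-\<^sub>1\<close> is the minimum for \<open>i = 1\<close>.\<close>
definition r_seq :: "'a::order_bot set \<Rightarrow> nat \<Rightarrow> (nat \<Rightarrow> 'a) \<Rightarrow> (nat \<Rightarrow> 'a) \<Rightarrow> int" where
  "r_seq P t y x =
     (let x = x(0 := bot) in
       (\<Sum>i = 1..t. poset_rank (plus_interval P (Fin (x (i - 1))) (Fin (y i)))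
                  - poset_rank (plus_interval P (Fin (x i)) (Fin (y i))))
       + poset_rank (plus_interval P (Fin (x t)) Pinf))"

lemma r_seq_empty: "r_seq P 0 y x = poset_rank (plus_poset P)"
proof -
  have "plus_interval P (Fin bot) Pinf = plus_poset P"
    by (auto simp: plus_interval_def plus_poset_def)
  then show ?thesis by (simp add: r_seq_def)
qed

definition r_max :: "'a::order_bot set \<Rightarrow> int" where
  "r_max P = Max {r_seq P t y x | t y x. condition_N P t y x}"

section \<open>The Hibi ring and its canonical module\<close>

text \<open>Polynomials over \<open>'k\<close> in indeterminates \<open>T\<^sub>x\<close> indexed by \<open>'a\<close>.\<close>
type_synonym ('a, 'k) mpoly = "('a \<Rightarrow>\<^sub>0 nat) \<Rightarrow>\<^sub>0 'k"

definition const_poly :: "'k::comm_ring_1 \<Rightarrow> ('a, 'k) mpoly" where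
  "const_poly c = Poly_Mapping.single 0 c"

definition indet :: "'a \<Rightarrow> ('a, 'k::comm_ring_1) mpoly" where
  "indet x = Poly_Mapping.single (Poly_Mapping.single x 1) 1"

inductive_set subalgebra_generated ::
    "('a, 'k::comm_ring_1) mpoly set \<Rightarrow> ('a, 'k) mpoly set"
  for G where
    const: "const_poly c \<in> subalgebra_generated G"
  | gen: "g \<in> G \<Longrightarrow> g \<in> subalgebra_generated G"
  | add: "f \<in> subalgebra_generated G \<Longrightarrow> g \<in> subalgebra_generated G
            \<Longrightarrow> f + g \<in> subalgebra_generated G"
  | mult: "f \<in> subalgebra_generated G \<Longrightarrow> g \<in> subalgebra_generated G
            \<Longrightarrow> f * g \<in> subalgebra_generated G"

definition hibi_ring :: "('a::lattice, 'k::field) mpoly set" where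
  "hibi_ring = subalgebra_generated
     (range (\<lambda>a::'a. \<Prod>x\<in>{x \<in> join_irreducibles. x \<le> a}. indet x))"

text \<open>Finite linear combinations of elements of \<open>G\<close> with coefficients in the subring \<open>R\<close>.\<close>
definition span_over :: "'r::comm_ring_1 set \<Rightarrow> 'r set \<Rightarrow> 'r set" where
  "span_over R G = {\<Sum>g\<in>F. c g * g | F c. finite F \<and> F \<subseteq> G \<and> (\<forall>g\<in>F. c g \<in> R)}"

text \<open>\<open>T\<^sup>\<nu>\<close>; only the values of \<open>\<nu>\<close> on \<open>P\<close> matter.\<close>
definition T_monomial :: "'a set \<Rightarrow> ('a \<Rightarrow> nat) \<Rightarrow> ('a, 'k::comm_ring_1) mpoly" where
  "T_monomial P \<nu> = (\<Prod>x\<in>P. indet x ^ \<nu> x)"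

definition strict_reversing_maps :: "'a::order set \<Rightarrow> ('a \<Rightarrow> nat) set" where
  "strict_reversing_maps P =
     {\<nu>. (\<forall>z\<in>P. \<nu> z > 0) \<and> (\<forall>x\<in>P. \<forall>y\<in>P. x < y \<longrightarrow> \<nu> x > \<nu> y)}"

text \<open>
  The standard monomial description of the canonical module of the (normal) Hibi ring, as the
  \<open>K\<close>-span of the monomials \<open>T\<^sup>\<nu>\<close> with \<open>\<nu>\<close> positive and strictly order-reversing on \<open>P\<close>.
\<close>
definition hibi_canonical_module :: "('a::lattice, 'k::field) mpoly set" where
  "hibi_canonical_module =
     span_over (range const_poly)
       (T_monomial join_irreducibles ` strict_reversing_maps join_irreducibles)"

definition minimal_generating_system :: "'r::comm_ring_1 set \<Rightarrow> 'r set \<Rightarrow> 'r set \<Rightarrow> bool" where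
  "minimal_generating_system R M G \<longleftrightarrow>
     span_over R G = M \<and> (\<forall>G'. G' \<subset> G \<longrightarrow> span_over R G' \<noteq> M)"

definition canonical_generator :: "('a::lattice, 'k::field) mpoly \<Rightarrow> bool" where
  "canonical_generator f \<longleftrightarrow>
     (\<exists>G. minimal_generating_system hibi_ring hibi_canonical_module G \<and>
          G \<subseteq> range (T_monomial join_irreducibles) \<and> f \<in> G)"

text \<open>
  The grading with \<open>deg T\<^sub>x = 1\<close> for \<open>x = x\<^sub>0\<close> and \<open>deg T\<^sub>x = 0\<close> otherwise: the degree of a
  monomial is its exponent at \<^term>\<open>bot\<close>.
\<close>
definition hibi_homogeneous :: "int \<Rightarrow> ('a::order_bot, 'k::field) mpoly \<Rightarrow> bool" where
  "hibi_homogeneous d f \<longleftrightarrow>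
     (\<forall>m\<in>Poly_Mapping.keys f. int (Poly_Mapping.lookup m bot) = d)"

end

theory Submission
  imports Defs
begin

text \<open>
  Extend \<open>\<nu>\<close> to \<open>P\<^sup>+\<close> by \<open>\<nu>(\<infinity>) = 0\<close>. The monomial \<open>T\<^sup>\<nu>\<close> is a generator iff no
  indicator function of a nonempty order ideal of \<open>P\<close> can be subtracted from \<open>\<nu>\<close>, that is, iff
  \<open>\<infinity>\<close> is reached from \<open>x\<^sub>0\<close> by steps going down in \<open>P\<^sup>+\<close> and steps going up along which \<open>\<nu>\<close>
  drops by exactly one.

  Let a sequence satisfy condition N. Put \<open>b\<^sub>t = rank [x\<^sub>t, \<infinity>]\<close>,
  \<open>a\<^sub>i = b\<^sub>i - rank [x\<^sub>i, y\<^sub>i]\<close>, \<open>b\<^sub>i\<^sub>-\<^sub>1 = a\<^sub>i + rank [x\<^sub>i\<^sub>-\<^sub>1, y\<^sub>i]\<close>, and let \<open>\<nu>(z)\<close> be the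
  maximum of \<open>rank [z, \<infinity>]\<close> and all \<open>a\<^sub>i + rank [z, y\<^sub>i]\<close> with \<open>z \<le> y\<^sub>i\<close>. Then \<open>\<nu>(x\<^sub>0)\<close> is at
  least \<open>b\<^sub>0 = r(y\<^sub>1, \<dots>, x\<^sub>t)\<close>. From \<open>x\<^sub>i\<close> one climbs to some \<open>y\<^sub>j\<close> realising the maximum at
  \<open>x\<^sub>i\<close>, where \<open>j > i\<close> may be assumed by clause (3), and descends to \<open>x\<^sub>j\<close>; eventually the maximum
  is realised by \<open>rank [x\<^sub>j, \<infinity>]\<close> and \<open>\<infinity>\<close> is reached. So \<open>T\<^sup>\<nu>\<close> is a generator. Finally,
  \<open>z \<mapsto> max (rank [z, \<infinity>]) (\<nu>(z) - j)\<close> is again a generator exponent for every \<open>j \<ge> 0\<close>, which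
  gives all degrees between \<open>r\<close> and \<open>\<nu>(x\<^sub>0)\<close>.
\<close>

section \<open>Ranks of intervals\<close>

lemma finite_chain_cards:
  assumes "finite A"
  shows "finite {int (card X) - 1 | X. X \<subseteq> A \<and> Complete_Partial_Order.chain (\<le>) X}"
  using finite_subset[of _ "(\<lambda>X. int (card X) - 1) ` Pow A"] assms by auto

lemma card_chain_le_poset_rank:
  assumes "finite A" "X \<subseteq> A" "Complete_Partial_Order.chain (\<le>) X"
  shows "int (card X) - 1 \<le> poset_rank A"
  unfolding poset_rank_def using assms by (intro Max_ge finite_chain_cards) auto

lemma poset_rank_attained:
  assumes "finite A"
  obtains X where "X \<subseteq> A" "Complete_Partial_Order.chain (\<le>) X" "poset_rank A = int (card X) - 1"
proof -
  \<comment> \<open>The empty chain contributes -1, so the set under \<open>Max\<close> is nonempty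
    even for empty \<open>A\<close>.\<close>
  have "{} \<subseteq> A \<and> Complete_Partial_Order.chain (\<le>) ({} :: 'a set)"
    by (simp add: chain_empty)
  then have "{int (card X) - 1 | X. X \<subseteq> A \<and> Complete_Partial_Order.chain (\<le>) X} \<noteq> {}"
    by blast
  from Max_in[OF finite_chain_cards[OF assms] this] that show thesis
    unfolding poset_rank_def by blast
qed

lemma finite_chain_least:
  assumes "finite C" "C \<noteq> {}" "Complete_Partial_Order.chain (\<le>) (C :: 'b::order set)"
  obtains m where "m \<in> C" "\<And>c. c \<in> C \<Longrightarrow> m \<le> c"
proof -
  obtain m where m: "m \<in> C" "\<And>c. c \<in> C \<Longrightarrow> c \<le> m \<Longrightarrow> m = c"
    using finite_has_minimal[OF assms(1,2)] by metis
  have "m \<le> c" if "c \<in> C" for c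
    using chainD[OF assms(3) m(1) that] m(2)[OF that] by auto
  with m(1) that show thesis by blast
qed

abbreviation interval_rank :: "'a::order set \<Rightarrow> 'a extended \<Rightarrow> 'a extended \<Rightarrow> int" where
  "interval_rank P x y \<equiv> poset_rank (plus_interval P x y)"

lemma finite_plus_interval: "finite P \<Longrightarrow> finite (plus_interval P x y)"
  by (simp add: plus_interval_def plus_poset_def)

lemma interval_rank_nonneg:
  assumes "finite P" "x \<in> plus_poset P" "x \<le> y"
  shows "0 \<le> interval_rank P x y"
  using card_chain_le_poset_rank[OF finite_plus_interval[OF assms(1)], of "{x}" x y] assms
  by (simp add: plus_interval_def chain_def)

lemma interval_rank_refl:
  assumes "finite P" "x \<in> plus_poset P"
  shows "interval_rank P x x = 0"
proof -
  obtain X where X: "X \<subseteq> plus_interval P x x" "interval_rank P x x = int (card X) - 1"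
    using poset_rank_attained[OF finite_plus_interval[OF assms(1)]] by metis
  have "X \<subseteq> {x}"
    using X(1) by (auto simp: plus_interval_def)
  then have "card X \<le> 1"
    using card_mono[of "{x}" X] by simp
  with X(2) interval_rank_nonneg[OF assms order_refl] show ?thesis by simp
qed

text \<open>A longest chain of the upper interval becomes one element longer when \<open>x\<close>
  is put below it.\<close>

lemma interval_rank_less:
  assumes "finite P" "x \<in> plus_poset P" "x < z" "z \<le> y"
  shows "interval_rank P z y < interval_rank P x y"
proof -
  obtain X where X: "X \<subseteq> plus_interval P z y" "Complete_Partial_Order.chain (\<le>) X"
    "interval_rank P z y = int (card X) - 1"
    using poset_rank_attained[OF finite_plus_interval[OF assms(1)]] by metis
  have fin: "finite X"
    using X(1) finite_plus_interval[OF assms(1)] finite_subset by blast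
  have above: "x < w" if "w \<in> X" for w
    using that X(1) assms(3) by (auto simp: plus_interval_def)
  have "insert x X \<subseteq> plus_interval P x y"
    using X(1) assms above by (fastforce simp: plus_interval_def)
  moreover have "Complete_Partial_Order.chain (\<le>) (insert x X)"
    using X(2) above unfolding chain_def by (metis insert_iff less_imp_le order_refl)
  ultimately have "int (card (insert x X)) - 1 \<le> interval_rank P x y"
    by (rule card_chain_le_poset_rank[OF finite_plus_interval[OF assms(1)]])
  moreover have "x \<notin> X"
    using above by blast
  ultimately show ?thesis
    using X(3) fin by simp
qed

text \<open>Take \<open>z\<close> to be the second element of a longest chain: deleting the least
  element leaves a chain in the interval from \<open>z\<close> to \<open>y\<close>. This allows
  induction on the rank.\<close>

lemma interval_rank_step:
  assumes "finite P" "x \<in> plus_poset P" "x < y" "y \<in> plus_poset P"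
  obtains z where "z \<in> plus_poset P" "x < z" "z \<le> y"
    "interval_rank P x y = interval_rank P z y + 1"
proof -
  obtain C where C: "C \<subseteq> plus_interval P x y" "Complete_Partial_Order.chain (\<le>) C"
    "interval_rank P x y = int (card C) - 1"
    using poset_rank_attained[OF finite_plus_interval[OF assms(1)]] by metis
  have fin: "finite C"
    using C(1) finite_plus_interval[OF assms(1)] finite_subset by blast
  have "0 \<le> interval_rank P y y" "interval_rank P y y < interval_rank P x y"
    using interval_rank_nonneg interval_rank_less assms by blast+
  then have card2: "card C \<ge> 2"
    using C(3) by linarith
  then have ne: "C \<noteq> {}" by auto
  obtain m where m: "m \<in> C" "\<And>c. c \<in> C \<Longrightarrow> m \<le> c"
    using finite_chain_least[OF fin ne C(2)] by blast
  have cardD: "int (card (C - {m})) = int (card C) - 1"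
    using m(1) fin card2 by simp
  have ne': "C - {m} \<noteq> {}"
  proof
    assume "C - {m} = {}"
    then have "card (C - {m}) = 0" by (simp only: card.empty)
    with cardD card2 show False by linarith
  qed
  have chain': "Complete_Partial_Order.chain (\<le>) (C - {m})"
    using C(2) unfolding chain_def by blast
  obtain z where z: "z \<in> C - {m}" "\<And>c. c \<in> C - {m} \<Longrightarrow> z \<le> c"
    using finite_chain_least[OF _ ne' chain'] fin by blast
  have "m < z"
    using z(1) m(2)[of z] by auto
  moreover have "x \<le> m"
    using C(1) m(1) by (auto simp: plus_interval_def)
  ultimately have xz: "x < z" by simp
  have zQ: "z \<in> plus_poset P" "z \<le> y"
    using z(1) C(1) by (auto simp: plus_interval_def)
  have "C - {m} \<subseteq> plus_interval P z y"
    using z(2) C(1) by (auto simp: plus_interval_def)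
  then have "int (card (C - {m})) - 1 \<le> interval_rank P z y"
    using chain' card_chain_le_poset_rank[OF finite_plus_interval[OF assms(1)]] by blast
  with interval_rank_less[OF assms(1,2) xz zQ(2)] C(3) cardD
  have "interval_rank P x y = interval_rank P z y + 1" by linarith
  with that xz zQ show thesis by blast
qed

section \<open>Rigid potentials\<close>

text \<open>Reachability by the steps described above is encoded through closed sets instead of
  paths: the points reachable from a start form the least closed set containing it.\<close>

definition tight_closed :: "'a::order set \<Rightarrow> ('a extended \<Rightarrow> int) \<Rightarrow> 'a extended set \<Rightarrow> bool" where
  "tight_closed P \<nu> I \<longleftrightarrow> I \<subseteq> plus_poset P \<and>
     (\<forall>x\<in>I. \<forall>z\<in>plus_poset P. z \<le> x \<or> x < z \<and> \<nu> x = \<nu> z + 1 \<longrightarrow> z \<in> I)"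

text \<open>The last clause expresses that \<open>Pinf\<close> is reachable from the bottom. Values
  are integers so that shifts and differences of ranks are not truncated.\<close>

definition rigid_potential :: "'a::order_bot set \<Rightarrow> ('a extended \<Rightarrow> int) \<Rightarrow> bool" where
  "rigid_potential P \<nu> \<longleftrightarrow> strict_antimono_on (plus_poset P) \<nu> \<and> \<nu> Pinf = 0 \<and>
     (\<forall>I. tight_closed P \<nu> I \<and> Fin bot \<in> I \<longrightarrow> Pinf \<in> I)"

text \<open>Along a longest chain from \<open>x\<close> to \<open>y\<close> the potential drops by
  at least one at each step.\<close>

lemma strict_antimono_rank_le:
  fixes \<nu> :: "'a::order extended \<Rightarrow> int"
  assumes "finite P" "strict_antimono_on (plus_poset P) \<nu>" "y \<in> plus_poset P"
  shows "x \<in> plus_poset P \<Longrightarrow> x \<le> y \<Longrightarrow> \<nu> y + interval_rank P x y \<le> \<nu> x"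
proof (induction "nat (interval_rank P x y)" arbitrary: x rule: less_induct)
  case less
  show ?case
  proof (cases "x = y")
    case True
    then show ?thesis using interval_rank_refl[OF assms(1,3)] by simp
  next
    case False
    then have "x < y" using less.prems by simp
    then obtain z where z: "z \<in> plus_poset P" "x < z" "z \<le> y"
      "interval_rank P x y = interval_rank P z y + 1"
      using interval_rank_step[OF assms(1) less.prems(1) _ assms(3)] by blast
    have "\<nu> y + interval_rank P z y \<le> \<nu> z"
      using less.hyps[of z] z interval_rank_nonneg[OF assms(1) z(1,3)] by simp
    moreover have "\<nu> z < \<nu> x"
      using assms(2) less.prems(1) z(1,2) by (auto simp: monotone_on_def)
    ultimately show ?thesis using z(4) by linarith
  qed
qed

text \<open>The assumed bound is the equality case of \<open>strict_antimono_rank_le\<close>. It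
  forces a drop of exactly one at each step of a longest chain from \<open>x\<close> to
  \<open>y\<close>, so \<open>I\<close> contains the whole chain.\<close>

lemma tight_closed_climb:
  fixes \<nu> :: "'a::order extended \<Rightarrow> int"
  assumes "finite P" "strict_antimono_on (plus_poset P) \<nu>" "y \<in> plus_poset P" "tight_closed P \<nu> I"
  shows "x \<in> I \<Longrightarrow> x \<le> y \<Longrightarrow> \<nu> x \<le> \<nu> y + interval_rank P x y \<Longrightarrow> y \<in> I"
proof (induction "nat (interval_rank P x y)" arbitrary: x rule: less_induct)
  case less
  have xQ: "x \<in> plus_poset P"
    using less.prems(1) assms(4) unfolding tight_closed_def by blast
  show ?case
  proof (cases "x = y")
    case True
    then show ?thesis using less.prems by simp
  next
    case False
    then have "x < y" using less.prems by simp
    then obtain z where z: "z \<in> plus_poset P" "x < z" "z \<le> y"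
      "interval_rank P x y = interval_rank P z y + 1"
      using interval_rank_step[OF assms(1) xQ _ assms(3)] by blast
    have "\<nu> y + interval_rank P z y \<le> \<nu> z"
      using strict_antimono_rank_le[OF assms(1-3) z(1,3)] .
    moreover have "\<nu> z < \<nu> x"
      using assms(2) xQ z(1,2) by (auto simp: monotone_on_def)
    ultimately have "\<nu> x = \<nu> z + 1" "\<nu> z \<le> \<nu> y + interval_rank P z y"
      using z(4) less.prems(3) by linarith+
    moreover from this have "z \<in> I"
      using assms(4) less.prems(1) z(1,2) unfolding tight_closed_def by blast
    ultimately show ?thesis
      using less.hyps[of z] z interval_rank_nonneg[OF assms(1) z(1,3)] by simp
  qed
qed

text \<open>If a closed set for the new potential misses \<open>Pinf\<close>, the rank term cannot
  attain the maximum at any of its points, since a longest chain would then lead to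
  \<open>Pinf\<close>. So on this set the new potential is \<nu> shifted by \<open>j\<close>, and
  the set is closed for \<nu> as well.\<close>

lemma rigid_potential_lower:
  assumes "finite P" "rigid_potential P \<nu>" "0 \<le> j"
  shows "rigid_potential P (\<lambda>z. max (interval_rank P z Pinf) (\<nu> z - j))"
    (is "rigid_potential P ?\<mu>")
proof -
  have strict: "\<nu> y < \<nu> x" if "x \<in> plus_poset P" "y \<in> plus_poset P" "x < y" for x y
    using that assms(2) by (auto simp: rigid_potential_def monotone_on_def)
  have inf: "(Pinf :: 'a extended) \<in> plus_poset P"
    by (simp add: plus_poset_def)
  have mu_strict: "?\<mu> y < ?\<mu> x" if "x \<in> plus_poset P" "y \<in> plus_poset P" "x < y" for x y
  proof -
    have "interval_rank P y Pinf < interval_rank P x Pinf"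
      using interval_rank_less[OF assms(1) that(1,3)] by simp
    then show ?thesis using strict[OF that] by linarith
  qed
  then have mono: "strict_antimono_on (plus_poset P) ?\<mu>"
    by (simp add: monotone_on_def)
  have mu_inf: "?\<mu> Pinf = 0"
    using assms(2,3) interval_rank_refl[OF assms(1) inf] by (simp add: rigid_potential_def)
  have "Pinf \<in> I" if I: "tight_closed P ?\<mu> I" "Fin bot \<in> I" for I
  proof (rule ccontr)
    assume notin: "Pinf \<notin> I"
    have "z \<in> I" if "x \<in> I" "z \<in> plus_poset P" "x < z" "\<nu> x = \<nu> z + 1" for x z
    proof (cases "\<nu> x - j \<le> interval_rank P x Pinf")
      case True
      then have "?\<mu> x \<le> ?\<mu> Pinf + interval_rank P x Pinf"
        using mu_inf by linarith
      from tight_closed_climb[OF assms(1) mono inf I(1) that(1) _ this] notin show ?thesis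
        by simp
    next
      case False
      have "x \<in> plus_poset P"
        using I(1) that(1) unfolding tight_closed_def by blast
      \<comment> \<open>Here \<open>?\<mu> x = \<nu> x - j\<close>, and
        \<open>?\<mu> z \<ge> \<nu> z - j = ?\<mu> x - 1\<close>, while strictness gives
        \<open>?\<mu> z < ?\<mu> x\<close>.\<close>
      then have "?\<mu> x = ?\<mu> z + 1"
        using mu_strict[of x z] that False by linarith
      then show ?thesis
        using I(1) that unfolding tight_closed_def by blast
    qed
    then have "tight_closed P \<nu> I"
      using I(1) unfolding tight_closed_def by blast
    with assms(2) I(2) notin show False unfolding rigid_potential_def by blast
  qed
  with mono mu_inf show ?thesis by (simp add: rigid_potential_def)
qed

section \<open>Potentials built from sequences with condition N\<close>

lemma condition_N_rigid_potential:
  fixes P :: "'a::order_bot set"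
  assumes "finite P" "bot \<in> P" "condition_N P t y x"
  obtains \<nu> where "rigid_potential P \<nu>" "r_seq P t y x \<le> \<nu> (Fin bot)"
proof -
  define X where "X = x(0 := bot)"
  \<comment> \<open>The recursion is solved in closed form: \<open>b i\<close> is
    \<open>r_seq\<close> with its first \<open>i\<close> summands dropped, so \<open>b 0\<close> is
    the full value, and \<open>b_step\<close> recovers the recursion.\<close>
  define b where "b i = (\<Sum>j = Suc i..t. interval_rank P (Fin (X (j - 1))) (Fin (y j))
      - interval_rank P (Fin (X j)) (Fin (y j))) + interval_rank P (Fin (X t)) Pinf" for i
  define a where "a i = b i - interval_rank P (Fin (X i)) (Fin (y i))" for i
  \<comment> \<open>The rank to \<open>Pinf\<close> keeps the set of candidates nonempty where no
    \<open>y i\<close> lies above \<open>z\<close>.\<close>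
  define V where "V z = insert (interval_rank P z Pinf)
      ((\<lambda>i. a i + interval_rank P z (Fin (y i))) ` {i \<in> {1..t}. z \<le> Fin (y i)})" for z
  define \<nu> where "\<nu> z = Max (V z)" for z
  have b0: "b 0 = r_seq P t y x"
    by (simp add: b_def r_seq_def X_def Let_def)
  have bt: "b t = interval_rank P (Fin (X t)) Pinf"
    by (simp add: b_def)
  have b_step: "b i = a (Suc i) + interval_rank P (Fin (X i)) (Fin (y (Suc i)))" if "i < t" for i
    using that by (simp add: a_def b_def sum.atLeast_Suc_atMost[of "Suc i" t])
  have PX: "X i \<in> P" if "i \<le> t" for i
    using assms(2,3) that by (cases i) (auto simp: X_def condition_N_def)
  have Py: "y i \<in> P" if "i \<in> {1..t}" for i
    using assms(3) that by (auto simp: condition_N_def)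
  have Xy: "X i < y i" if "i \<in> {1..t}" for i
    using assms(3) that by (auto simp: condition_N_def X_def)
  have Xy_Suc: "X i \<le> y (Suc i)" if "i < t" for i
    using assms(3) that by (cases i) (auto simp: condition_N_def X_def less_imp_le)
  have N3: "\<not> X i \<le> y j" if "1 \<le> j" "j < i" "i \<le> t" for i j
    using assms(3) that by (auto simp: condition_N_def X_def)
  have inf: "(Pinf :: 'a extended) \<in> plus_poset P"
    by (simp add: plus_poset_def)
  have Fin_Q: "Fin p \<in> plus_poset P" if "p \<in> P" for p
    using that by (simp add: plus_poset_def)
  have finV: "finite (V z)" and neV: "V z \<noteq> {}" for z
    by (simp_all add: V_def)
  have \<nu>_rank: "interval_rank P z Pinf \<le> \<nu> z" for z
    unfolding \<nu>_def by (rule Max_ge[OF finV]) (simp add: V_def)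
  have \<nu>_ge: "a i + interval_rank P z (Fin (y i)) \<le> \<nu> z" if "i \<in> {1..t}" "z \<le> Fin (y i)" for i z
    unfolding \<nu>_def using that by (intro Max_ge[OF finV]) (simp add: V_def)
  have \<nu>_cases: "\<nu> z = interval_rank P z Pinf \<or>
      (\<exists>i\<in>{1..t}. z \<le> Fin (y i) \<and> \<nu> z = a i + interval_rank P z (Fin (y i)))" for z
    using Max_in[OF finV[of z] neV[of z]] unfolding \<nu>_def[symmetric] by (auto simp: V_def)
  \<comment> \<open>The candidate attaining the maximum at \<open>w\<close> is also available at the
    smaller \<open>z\<close>, with a larger rank.\<close>
  have \<nu>_strict: "\<nu> w < \<nu> z" if "z \<in> plus_poset P" "z < w" for z w
    using \<nu>_cases[of w]
  proof (elim disjE bexE conjE)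
    assume "\<nu> w = interval_rank P w Pinf"
    then show ?thesis
      using interval_rank_less[OF assms(1) that, of Pinf] \<nu>_rank[of z] by simp
  next
    fix i assume "i \<in> {1..t}" "w \<le> Fin (y i)" "\<nu> w = a i + interval_rank P w (Fin (y i))"
    then show ?thesis
      using interval_rank_less[OF assms(1) that, of "Fin (y i)"] \<nu>_ge[of i z] that(2) by force
  qed
  then have mono: "strict_antimono_on (plus_poset P) \<nu>"
    by (simp add: monotone_on_def)
  have \<nu>_inf: "\<nu> Pinf = 0"
    using \<nu>_cases[of Pinf] interval_rank_refl[OF assms(1) inf] by auto
  have "Pinf \<in> I" if I: "tight_closed P \<nu> I" "Fin bot \<in> I" for I
  proof (rule ccontr)
    assume notin: "Pinf \<notin> I"
    have "\<exists>j>i. j \<le> t \<and> Fin (X j) \<in> I" if i: "i \<le> t" "Fin (X i) \<in> I" for i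
    proof -
      have not_rank: "\<nu> (Fin (X i)) \<noteq> interval_rank P (Fin (X i)) Pinf"
        using tight_closed_climb[OF assms(1) mono inf I(1) i(2)] \<nu>_inf notin by auto
      then obtain k where k: "k \<in> {1..t}" "X i \<le> y k"
        "\<nu> (Fin (X i)) = a k + interval_rank P (Fin (X i)) (Fin (y k))"
        using \<nu>_cases[of "Fin (X i)"] by auto
      \<comment> \<open>The index \<open>k\<close> cannot be below \<open>i\<close> by clause (3).
        If \<open>k = i\<close>, the value is \<open>b i\<close>, which the candidate of index
        \<open>Suc i\<close> attains too; \<open>i = t\<close> is excluded because
        \<open>b t\<close> is the rank to \<open>Pinf\<close>.\<close>
      obtain j where j: "i < j" "j \<le> t" "X i \<le> y j"
        "\<nu> (Fin (X i)) = a j + interval_rank P (Fin (X i)) (Fin (y j))"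
      proof (cases "k = i")
        case True
        then have "\<nu> (Fin (X i)) = b i"
          using k(3) by (simp add: a_def)
        moreover from this have "i < t"
          using bt not_rank i(1) by (cases "i = t") auto
        ultimately show thesis
          using that[of "Suc i"] b_step[of i] Xy_Suc[of i] by simp
      next
        case False
        then have "i < k"
          using N3[of k i] k(1,2) i(1) by force
        with k that show thesis by simp
      qed
      have j1: "j \<in> {1..t}" using j(1,2) by simp
      \<comment> \<open>The candidate of index \<open>j\<close> at \<open>y j\<close> itself has
        rank 0; this gives the bound needed to climb from \<open>X i\<close> to
        \<open>y j\<close>.\<close>
      have "a j \<le> \<nu> (Fin (y j))"
        using \<nu>_ge[OF j1, of "Fin (y j)"] interval_rank_refl[OF assms(1) Fin_Q[OF Py[OF j1]]]
        by simp
      then have "Fin (y j) \<in> I"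
        using tight_closed_climb[OF assms(1) mono Fin_Q[OF Py[OF j1]] I(1) i(2)] j by simp
      then have "Fin (X j) \<in> I"
        using I(1) Xy[OF j1] Fin_Q[OF PX[OF j(2)]] unfolding tight_closed_def
        by (metis less_imp_le less_eq_extended.simps(1))
      with j show ?thesis by blast
    qed
    \<comment> \<open>The finite set of reached indices contains 0 but would have no largest
      element.\<close>
    moreover define S where "S = {i. i \<le> t \<and> Fin (X i) \<in> I}"
    ultimately have "\<exists>j\<in>S. i < j" if "i \<in> S" for i
      using that by blast
    moreover have "finite S" "0 \<in> S"
      using I(2) by (simp_all add: S_def X_def)
    ultimately show False
      by (metis Max_in Max_ge empty_iff linorder_not_less)
  qed
  with mono \<nu>_inf have "rigid_potential P \<nu>"
    by (simp add: rigid_potential_def)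
  moreover have "b 0 \<le> \<nu> (Fin bot)"
  proof (cases "t = 0")
    case True
    then show ?thesis using bt \<nu>_rank[of "Fin bot"] by (simp add: X_def)
  next
    case False
    then show ?thesis
      using b_step[of 0] \<nu>_ge[of 1 "Fin bot"] by (simp add: X_def)
  qed
  ultimately show thesis using that b0 by simp
qed

section \<open>Finiteness of the set of values of sequences\<close>

text \<open>For \<open>i < j\<close>, the element \<open>x i\<close> lies below \<open>y i\<close>
  and \<open>x j\<close> does not, so the \<open>x i\<close> are distinct.\<close>

lemma condition_N_length:
  assumes "finite P" "condition_N P t y x"
  shows "t \<le> card P"
proof -
  have "inj_on x {1..t}"
  proof (rule linorder_inj_onI)
    fix i j assume "i < j" "i \<in> {1..t}" "j \<in> {1..t}"
    then have "x i < y i" "\<not> x j \<le> y i"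
      using assms(2) by (auto simp: condition_N_def)
    then show "x i \<noteq> x j" by auto
  qed auto
  moreover have "x ` {1..t} \<subseteq> P"
    using assms(2) by (auto simp: condition_N_def)
  ultimately show ?thesis
    using card_inj_on_le[OF _ _ assms(1)] by fastforce
qed

lemma r_seq_cong:
  assumes "\<And>i. i \<in> {1..t} \<Longrightarrow> y i = y' i" "\<And>i. i \<in> {1..t} \<Longrightarrow> x i = x' i"
  shows "r_seq P t y x = r_seq P t y' x'"
proof -
  define X X' where "X = x(0 := bot)" and "X' = x'(0 := bot)"
  have "X i = X' i" if "i \<le> t" for i
    using that assms(2)[of i] by (cases i) (auto simp: X_def X'_def)
  then show ?thesis
    unfolding r_seq_def Let_def X_def[symmetric] X'_def[symmetric] using assms(1)
    by (intro arg_cong2[of _ _ _ _ "(+)"] sum.cong) auto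
qed

text \<open>\<open>Max\<close> is meaningful only for a finite nonempty set. There may be infinitely
  many pairs of functions, but by \<open>r_seq_cong\<close> each value is already taken on functions
  from the finite set \<open>F\<close>.\<close>

lemma r_max_attained:
  fixes P :: "'a::order_bot set"
  assumes "finite P" "bot \<in> P"
  obtains t y x where "condition_N P t y x" "r_max P = r_seq P t y x"
proof -
  let ?R = "{r_seq P t y x | t y x. condition_N P t y x}"
  let ?N = "{1..card P}"
  define F where "F = {f :: nat \<Rightarrow> 'a. \<forall>i. (i \<in> ?N \<longrightarrow> f i \<in> P) \<and> (i \<notin> ?N \<longrightarrow> f i = bot)}"
  have "finite F"
    unfolding F_def by (intro finite_set_of_finite_funs) (use assms in auto)
  have "?R \<subseteq> (\<lambda>(t, y, x). r_seq P t y x) ` ({..card P} \<times> F \<times> F)"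
  proof clarify
    fix t y x assume N: "condition_N P t y x"
    then have t: "t \<le> card P"
      using condition_N_length[OF assms(1)] by blast
    \<comment> \<open>The default \<open>bot\<close> must lie in \<open>P\<close>, because positions
      after \<open>t\<close> may still belong to \<open>?N\<close>.\<close>
    define res :: "(nat \<Rightarrow> 'a) \<Rightarrow> nat \<Rightarrow> 'a"
      where "res f i = (if i \<in> {1..t} then f i else bot)" for f i
    have "res y \<in> F" "res x \<in> F"
      using N t assms(2) by (auto simp: F_def res_def condition_N_def)
    moreover have "r_seq P t y x = r_seq P t (res y) (res x)"
      by (rule r_seq_cong) (simp_all add: res_def)
    ultimately show "r_seq P t y x \<in> (\<lambda>(t, y, x). r_seq P t y x) ` ({..card P} \<times> F \<times> F)"
      using t by (intro image_eqI[of _ _ "(t, res y, res x)"]) auto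
  qed
  then have "finite ?R"
    using \<open>finite F\<close> finite_subset by blast
  moreover have "condition_N P 0 (\<lambda>_. bot) (\<lambda>_. bot)"
    by (simp add: condition_N_def)
  then have "?R \<noteq> {}" by blast
  ultimately show thesis
    using Max_in[of ?R] that unfolding r_max_def by blast
qed

section \<open>Polynomials with prescribed exponents\<close>

abbreviation monomial :: "('a \<Rightarrow>\<^sub>0 nat) \<Rightarrow> ('a, 'k::comm_ring_1) mpoly" where
  "monomial m \<equiv> Poly_Mapping.single m 1"

text \<open>The ring, the field of constants and the canonical module are all spanned over the field
  by monomials, so each is determined by a set of exponents.\<close>

definition supported_on :: "('a \<Rightarrow>\<^sub>0 nat) set \<Rightarrow> ('a, 'k::comm_ring_1) mpoly set" where
  "supported_on S = {f. Poly_Mapping.keys f \<subseteq> S}"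

lemma poly_mapping_sum_single:
  "(\<Sum>k\<in>Poly_Mapping.keys f. Poly_Mapping.single k (Poly_Mapping.lookup f k)) = f"
proof (rule poly_mapping_eqI)
  fix k
  have "Poly_Mapping.lookup (\<Sum>k\<in>Poly_Mapping.keys f. Poly_Mapping.single k (Poly_Mapping.lookup f k)) k
      = (\<Sum>l\<in>Poly_Mapping.keys f. if k = l then Poly_Mapping.lookup f l else 0)"
    by (auto simp: lookup_sum lookup_single when_def intro!: sum.cong)
  also have "\<dots> = Poly_Mapping.lookup f k"
    by (simp add: in_keys_iff)
  finally show "Poly_Mapping.lookup (\<Sum>k\<in>Poly_Mapping.keys f.
      Poly_Mapping.single k (Poly_Mapping.lookup f k)) k = Poly_Mapping.lookup f k" .
qed

text \<open>This turns questions of generation by monomials into questions about sums of exponent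
  sets.\<close>

lemma span_over_supported_on:
  "span_over (supported_on B) (monomial ` S) =
     (supported_on {b + s | b s. b \<in> B \<and> s \<in> S} :: ('a, 'k::comm_ring_1) mpoly set)"
proof (intro subset_antisym subsetI)
  fix f :: "('a, 'k) mpoly"
  assume "f \<in> span_over (supported_on B) (monomial ` S)"
  then obtain F c where F: "finite F" "F \<subseteq> monomial ` S" "\<forall>g\<in>F. c g \<in> supported_on B"
    and f: "f = (\<Sum>g\<in>F. c g * g)"
    unfolding span_over_def by blast
  have "Poly_Mapping.keys (c g * g) \<subseteq> {b + s | b s. b \<in> B \<and> s \<in> S}" if g: "g \<in> F" for g
  proof -
    obtain s where s: "s \<in> S" "g = monomial s"
      using g F(2) by blast
    have "Poly_Mapping.keys (c g) \<subseteq> B"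
      using F(3) g by (auto simp: supported_on_def)
    moreover have "Poly_Mapping.keys g \<subseteq> {s}"
      using s(2) by simp
    ultimately show ?thesis
      using keys_mult[of "c g" g] s(1) by blast
  qed
  then show "f \<in> supported_on {b + s | b s. b \<in> B \<and> s \<in> S}"
    unfolding supported_on_def f mem_Collect_eq using keys_sum[of "\<lambda>g. c g * g" F] by blast
next
  fix f :: "('a, 'k) mpoly"
  assume "f \<in> supported_on {b + s | b s. b \<in> B \<and> s \<in> S}"
  then have "\<forall>m\<in>Poly_Mapping.keys f. \<exists>b s. b \<in> B \<and> s \<in> S \<and> m = b + s"
    unfolding supported_on_def by blast
  then obtain b s where bs: "\<And>m. m \<in> Poly_Mapping.keys f \<Longrightarrow> b m \<in> B \<and> s m \<in> S \<and> m = b m + s m"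
    by metis
  define h :: "('a \<Rightarrow>\<^sub>0 nat) \<Rightarrow> ('a, 'k) mpoly" where "h m = monomial (s m)" for m
  \<comment> \<open>Several exponents may have the same chosen part \<open>s m\<close>; their
    cofactors are collected into the single coefficient that \<open>span_over\<close> allows per
    generator.\<close>
  define c where "c g = (\<Sum>m\<in>{m \<in> Poly_Mapping.keys f. h m = g}.
      Poly_Mapping.single (b m) (Poly_Mapping.lookup f m))" for g
  have "(\<Sum>g\<in>h ` Poly_Mapping.keys f. c g * g) =
      (\<Sum>g\<in>h ` Poly_Mapping.keys f. \<Sum>m\<in>{m \<in> Poly_Mapping.keys f. h m = g}.
        Poly_Mapping.single m (Poly_Mapping.lookup f m))"
  proof (rule sum.cong[OF refl])
    fix g
    show "c g * g = (\<Sum>m\<in>{m \<in> Poly_Mapping.keys f. h m = g}.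
        Poly_Mapping.single m (Poly_Mapping.lookup f m))"
      unfolding c_def sum_distrib_right
    proof (rule sum.cong[OF refl])
      fix m assume "m \<in> {m \<in> Poly_Mapping.keys f. h m = g}"
      then have m: "m \<in> Poly_Mapping.keys f" "g = monomial (s m)"
        by (simp_all add: h_def)
      then have "m = b m + s m" using bs by blast
      then show "Poly_Mapping.single (b m) (Poly_Mapping.lookup f m) * g =
          Poly_Mapping.single m (Poly_Mapping.lookup f m)"
        using m(2) by (simp add: mult_single)
    qed
  qed
  also have "\<dots> = f"
    by (simp add: sum.group poly_mapping_sum_single)
  finally have "f = (\<Sum>g\<in>h ` Poly_Mapping.keys f. c g * g)" ..
  moreover have "h ` Poly_Mapping.keys f \<subseteq> monomial ` S"
    using bs by (auto simp: h_def)
  moreover have "c g \<in> supported_on B" for g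
    using bs by (auto simp: c_def supported_on_def dest!: subsetD[OF keys_sum] split: if_splits)
  moreover have "finite (h ` Poly_Mapping.keys f)"
    by simp
  ultimately show "f \<in> span_over (supported_on B) (monomial ` S)"
    unfolding span_over_def mem_Collect_eq by (intro exI conjI ballI) assumption+
qed

lemma range_const_poly: "range const_poly = supported_on {0}"
proof (intro subset_antisym subsetI)
  fix f :: "('a, 'k::comm_ring_1) mpoly"
  assume "f \<in> supported_on {0}"
  then have "f = (\<Sum>k\<in>{0}. Poly_Mapping.single k (Poly_Mapping.lookup f k))"
    using poly_mapping_sum_single[of f]
    by (cases "Poly_Mapping.keys f = {}") (auto simp: supported_on_def subset_singleton_iff)
  then show "f \<in> range const_poly"
    unfolding const_poly_def by auto
qed (auto simp: const_poly_def supported_on_def split: if_splits)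

definition exponent :: "'a set \<Rightarrow> ('a \<Rightarrow> nat) \<Rightarrow> 'a \<Rightarrow>\<^sub>0 nat" where
  "exponent P \<nu> = (\<Sum>x\<in>P. Poly_Mapping.single x (\<nu> x))"

lemma lookup_exponent:
  assumes "finite P"
  shows "Poly_Mapping.lookup (exponent P \<nu>) z = (if z \<in> P then \<nu> z else 0)"
proof -
  have "Poly_Mapping.lookup (exponent P \<nu>) z = (\<Sum>x\<in>P. if z = x then \<nu> x else 0)"
    by (auto simp: exponent_def lookup_sum lookup_single when_def intro!: sum.cong)
  with assms show ?thesis by simp
qed

lemma keys_exponent: "finite P \<Longrightarrow> Poly_Mapping.keys (exponent P \<nu>) \<subseteq> P"
  by (auto simp: in_keys_iff lookup_exponent split: if_splits)

lemma indet_power: "indet x ^ n = (monomial (Poly_Mapping.single x n) :: ('a, 'k::comm_ring_1) mpoly)"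
  by (induction n) (simp_all add: indet_def mult_single flip: single_add)

lemma T_monomial_exponent:
  "finite P \<Longrightarrow> T_monomial P \<nu> = (monomial (exponent P \<nu>) :: ('a, 'k::comm_ring_1) mpoly)"
  unfolding T_monomial_def exponent_def
  by (induction P rule: finite_induct) (simp_all add: indet_power mult_single)

section \<open>Exponents of the Hibi ring and of its canonical module\<close>

text \<open>Vanishing outside \<open>P\<close> makes the exponent of a monomial unique. That these
  are the exponents of the Hibi ring is proved in \<open>hibi_ring_eq\<close>.\<close>

definition ring_exponents :: "'a::order set \<Rightarrow> ('a \<Rightarrow>\<^sub>0 nat) set" where
  "ring_exponents P = {m. Poly_Mapping.keys m \<subseteq> P \<and>
     (\<forall>x\<in>P. \<forall>y\<in>P. x \<le> y \<longrightarrow> Poly_Mapping.lookup m y \<le> Poly_Mapping.lookup m x)}"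

definition canonical_exponents :: "'a::order set \<Rightarrow> ('a \<Rightarrow>\<^sub>0 nat) set" where
  "canonical_exponents P =
     {m. Poly_Mapping.keys m \<subseteq> P \<and> Poly_Mapping.lookup m \<in> strict_reversing_maps P}"

lemma zero_ring_exponents: "0 \<in> ring_exponents P"
  by (simp add: ring_exponents_def)

lemma add_ring_exponents:
  "m \<in> ring_exponents P \<Longrightarrow> n \<in> ring_exponents P \<Longrightarrow> m + n \<in> ring_exponents P"
  using keys_add[of m n] unfolding ring_exponents_def by (auto simp: lookup_add intro!: add_mono)

lemma add_canonical_exponents:
  assumes "m \<in> ring_exponents P" "n \<in> canonical_exponents P"
  shows "m + n \<in> canonical_exponents P"
proof -
  have "Poly_Mapping.lookup m y + Poly_Mapping.lookup n y <
      Poly_Mapping.lookup m x + Poly_Mapping.lookup n x" if "x \<in> P" "y \<in> P" "x < y" for x y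
    using assms that
    by (intro add_le_less_mono) (auto simp: ring_exponents_def canonical_exponents_def strict_reversing_maps_def)
  moreover have "0 < Poly_Mapping.lookup n z" if "z \<in> P" for z
    using assms(2) that by (simp add: canonical_exponents_def strict_reversing_maps_def)
  moreover have "Poly_Mapping.keys (m + n) \<subseteq> P"
    using assms keys_add[of m n] by (auto simp: ring_exponents_def canonical_exponents_def)
  ultimately show ?thesis
    by (simp add: canonical_exponents_def strict_reversing_maps_def lookup_add)
qed

text \<open>An order-reversing map is largest at \<open>bot\<close>. Hence splitting off a nonzero
  ring exponent lowers the degree, and inductions on the degree terminate.\<close>

lemma lookup_bot_pos:
  fixes P :: "'a::order_bot set"
  assumes "bot \<in> P" "m \<in> ring_exponents P" "m \<noteq> 0"
  shows "0 < Poly_Mapping.lookup m bot"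
proof -
  obtain x where "x \<in> Poly_Mapping.keys m"
    using assms(3) by (metis keys_eq_empty all_not_in_conv)
  moreover from this have "Poly_Mapping.lookup m x \<le> Poly_Mapping.lookup m bot"
    using assms(1,2) by (auto simp: ring_exponents_def)
  ultimately show ?thesis
    by (simp add: in_keys_iff)
qed

lemma T_monomial_image:
  fixes P :: "'a::order set"
  assumes "finite P"
  shows "T_monomial P ` strict_reversing_maps P =
    (monomial ` canonical_exponents P :: ('a, 'k::comm_ring_1) mpoly set)"
proof -
  have "exponent P ` strict_reversing_maps P = canonical_exponents P"
  proof (intro subset_antisym subsetI)
    fix m assume "m \<in> exponent P ` strict_reversing_maps P"
    then show "m \<in> canonical_exponents P"
      using keys_exponent[OF assms]
      by (auto simp: canonical_exponents_def strict_reversing_maps_def lookup_exponent[OF assms])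
  next
    fix m assume m: "m \<in> canonical_exponents P"
    then have "m = exponent P (Poly_Mapping.lookup m)"
      by (intro poly_mapping_eqI) (auto simp: lookup_exponent[OF assms] canonical_exponents_def in_keys_iff)
    with m show "m \<in> exponent P ` strict_reversing_maps P"
      by (auto simp: canonical_exponents_def)
  qed
  then show ?thesis
    using T_monomial_exponent[OF assms] by (metis (no_types, lifting) image_cong image_image)
qed

section \<open>Join-irreducible elements and the monomials of the Hibi ring\<close>

lemma bot_join_irreducible: "(bot :: 'a::bounded_lattice_bot) \<in> join_irreducibles"
  by (auto simp: join_irreducibles_def)

text \<open>By distributivity \<open>p\<close> is the join of \<open>inf p b\<close> and
  \<open>inf p c\<close>, hence equal to one of them.\<close>

lemma join_irreducible_prime:
  fixes p :: "'a::distrib_lattice"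
  assumes "p \<in> join_irreducibles" "p \<le> sup b c"
  shows "p \<le> b \<or> p \<le> c"
proof -
  have "p = sup (inf p b) (inf p c)"
    using assms(2) by (metis inf.absorb1 inf_sup_distrib1)
  then have "p = inf p b \<or> p = inf p c"
    using assms(1) unfolding join_irreducibles_def by blast
  then show ?thesis
    by (metis inf.cobounded2)
qed

lemma join_irreducible_le_Sup_fin:
  fixes p :: "'a::distrib_lattice"
  assumes "p \<in> join_irreducibles" "finite I" "I \<noteq> {}" "p \<le> Sup_fin I"
  shows "\<exists>i\<in>I. p \<le> i"
  using assms(2-4)
proof (induction I rule: finite_ne_induct)
  case (insert x F)
  then show ?case
    using join_irreducible_prime[OF assms(1), of x "Sup_fin F"] by auto
qed simp

text \<open>Birkhoff's correspondence: by primeness, a join-irreducible below the join of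
  \<open>I\<close> lies below a member of \<open>I\<close>.\<close>

lemma order_ideal_principal:
  fixes I :: "'a::distrib_lattice set"
  assumes "finite I" "I \<noteq> {}" "I \<subseteq> join_irreducibles"
    and "\<And>x y. y \<in> I \<Longrightarrow> x \<in> join_irreducibles \<Longrightarrow> x \<le> y \<Longrightarrow> x \<in> I"
  shows "{x \<in> join_irreducibles. x \<le> Sup_fin I} = I"
  using join_irreducible_le_Sup_fin[OF _ assms(1,2)] assms Sup_fin.coboundedI[OF assms(1)] by blast

lemma hibi_ring_sum:
  assumes "finite A" "\<And>i. i \<in> A \<Longrightarrow> g i \<in> hibi_ring"
  shows "(\<Sum>i\<in>A. g i) \<in> (hibi_ring :: ('a::lattice, 'k::field) mpoly set)"
  using assms
proof (induction A rule: finite_induct)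
  case empty
  have "const_poly 0 \<in> (hibi_ring :: ('a, 'k) mpoly set)"
    unfolding hibi_ring_def by (rule subalgebra_generated.const)
  then show ?case by (simp add: const_poly_def)
next
  case (insert x F)
  then show ?case
    unfolding hibi_ring_def by (simp add: subalgebra_generated.add)
qed

definition lattice_exponent :: "'a::{finite, lattice} \<Rightarrow> 'a \<Rightarrow>\<^sub>0 nat" where
  "lattice_exponent a = exponent join_irreducibles (\<lambda>x. of_bool (x \<le> a))"

lemma prod_indet_lattice_exponent:
  "(\<Prod>x\<in>{x \<in> join_irreducibles. x \<le> a}. indet x) =
     (monomial (lattice_exponent a) :: ('a::{finite, lattice}, 'k::field) mpoly)"
proof -
  have "(\<Prod>x\<in>{x \<in> join_irreducibles. x \<le> a}. indet x) =
      (T_monomial join_irreducibles (\<lambda>x. of_bool (x \<le> a)) :: ('a, 'k) mpoly)"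
    unfolding T_monomial_def by (subst prod.inter_filter) (auto intro!: prod.cong)
  then show ?thesis
    by (simp add: T_monomial_exponent lattice_exponent_def)
qed

lemma lookup_lattice_exponent:
  "Poly_Mapping.lookup (lattice_exponent a) x = of_bool (x \<in> join_irreducibles \<and> x \<le> a)"
  by (simp add: lattice_exponent_def lookup_exponent)

lemma lattice_exponent_ring_exponents:
  "lattice_exponent a \<in> ring_exponents join_irreducibles"
  unfolding ring_exponents_def using order_trans
  by (auto simp: lookup_lattice_exponent in_keys_iff)

text \<open>The support of a nonzero exponent is an order ideal, hence consists of the
  join-irreducibles below some \<open>a\<close>. Dividing by the generator of \<open>a\<close>
  lowers the degree, and induction applies to the quotient.\<close>

lemma monomial_hibi_ring:
  fixes m :: "'a::{finite, distrib_lattice, bounded_lattice_bot} \<Rightarrow>\<^sub>0 nat"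
  assumes "m \<in> ring_exponents join_irreducibles"
  shows "(monomial m :: ('a, 'k::field) mpoly) \<in> hibi_ring"
  using assms
proof (induction "Poly_Mapping.lookup m bot" arbitrary: m rule: less_induct)
  case less
  show ?case
  proof (cases "m = 0")
    case True
    have "const_poly 1 \<in> (hibi_ring :: ('a, 'k) mpoly set)"
      unfolding hibi_ring_def by (rule subalgebra_generated.const)
    with True show ?thesis by (simp add: const_poly_def)
  next
    case False
    define I where "I = Poly_Mapping.keys m"
    have m: "I \<subseteq> join_irreducibles"
      "\<And>x y. x \<in> join_irreducibles \<Longrightarrow> y \<in> join_irreducibles \<Longrightarrow> x \<le> y \<Longrightarrow>
        Poly_Mapping.lookup m y \<le> Poly_Mapping.lookup m x"
      using less.prems by (auto simp: ring_exponents_def I_def)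
    have ne: "I \<noteq> {}"
      using False by (simp add: I_def)
    have down: "x \<in> I" if "y \<in> I" "x \<in> join_irreducibles" "x \<le> y" for x y
    proof -
      have "Poly_Mapping.lookup m y \<le> Poly_Mapping.lookup m x"
        using m that by blast
      with that(1) show ?thesis by (simp add: I_def in_keys_iff)
    qed
    define a where "a = Sup_fin I"
    have I: "{x \<in> join_irreducibles. x \<le> a} = I"
      unfolding a_def using order_ideal_principal[OF _ ne m(1) down] by simp
    have look: "Poly_Mapping.lookup (lattice_exponent a) x = of_bool (x \<in> I)" for x
      using I by (auto simp: lookup_lattice_exponent)
    define m' where "m' = m - lattice_exponent a"
    have look': "Poly_Mapping.lookup m' x = Poly_Mapping.lookup m x - of_bool (x \<in> I)" for x
      by (simp add: m'_def lookup_minus look)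
    have eq: "m = lattice_exponent a + m'"
      by (rule poly_mapping_eqI) (auto simp: lookup_add look look' I_def in_keys_iff)
    have "Poly_Mapping.keys m' \<subseteq> join_irreducibles"
      using m(1) by (auto simp: in_keys_iff look' I_def)
    \<comment> \<open>If \<open>y\<close> is in the ideal \<open>I\<close>, so is \<open>x\<close>,
      and both values drop by one; otherwise the value at \<open>y\<close> is 0.\<close>
    moreover have "Poly_Mapping.lookup m' y \<le> Poly_Mapping.lookup m' x"
      if "x \<in> join_irreducibles" "y \<in> join_irreducibles" "x \<le> y" for x y
      using m(2)[OF that] down[OF _ that(1,3)]
      by (cases "y \<in> I") (auto simp: look' I_def in_keys_iff)
    ultimately have "m' \<in> ring_exponents join_irreducibles"
      by (simp add: ring_exponents_def)
    moreover have "0 < Poly_Mapping.lookup m bot"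
      by (rule lookup_bot_pos[OF bot_join_irreducible less.prems False])
    then have "Poly_Mapping.lookup m' bot < Poly_Mapping.lookup m bot"
      by (auto simp: look' I_def in_keys_iff)
    ultimately have "monomial m' \<in> (hibi_ring :: ('a, 'k) mpoly set)"
      using less.hyps by blast
    moreover have "monomial (lattice_exponent a) \<in> (hibi_ring :: ('a, 'k) mpoly set)"
      unfolding hibi_ring_def prod_indet_lattice_exponent
      by (rule subalgebra_generated.gen) blast
    ultimately have "monomial (lattice_exponent a) * monomial m' \<in> (hibi_ring :: ('a, 'k) mpoly set)"
      unfolding hibi_ring_def by (intro subalgebra_generated.mult)
    then show ?thesis
      using eq by (simp add: mult_single)
  qed
qed

lemma hibi_ring_eq:
  "hibi_ring = (supported_on (ring_exponents join_irreducibles) ::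
     ('a::{finite, distrib_lattice, bounded_lattice_bot}, 'k::field) mpoly set)"
proof (intro subset_antisym subsetI)
  fix f :: "('a, 'k) mpoly"
  assume "f \<in> hibi_ring"
  then show "f \<in> supported_on (ring_exponents join_irreducibles)"
    unfolding hibi_ring_def prod_indet_lattice_exponent
  proof induction
    case (const c)
    then show ?case
      by (simp add: supported_on_def const_poly_def zero_ring_exponents)
  next
    case (gen g)
    then show ?case
      using lattice_exponent_ring_exponents by (auto simp: supported_on_def)
  next
    case (add f g)
    then show ?case
      using keys_add[of f g] by (auto simp: supported_on_def)
  next
    case (mult f g)
    then show ?case
      using keys_mult[of f g] add_ring_exponents unfolding supported_on_def mem_Collect_eq by blast
  qed
next
  fix f :: "('a, 'k) mpoly"
  assume f: "f \<in> supported_on (ring_exponents join_irreducibles)"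
  have "Poly_Mapping.single m c \<in> (hibi_ring :: ('a, 'k) mpoly set)"
    if "m \<in> ring_exponents join_irreducibles" for m c
  proof -
    have "const_poly c * monomial m \<in> (hibi_ring :: ('a, 'k) mpoly set)"
      using monomial_hibi_ring[OF that] unfolding hibi_ring_def
      by (intro subalgebra_generated.mult subalgebra_generated.const)
    then show ?thesis
      by (simp add: const_poly_def mult_single)
  qed
  then have "(\<Sum>k\<in>Poly_Mapping.keys f. Poly_Mapping.single k (Poly_Mapping.lookup f k)) \<in> hibi_ring"
    using f by (intro hibi_ring_sum) (auto simp: supported_on_def)
  then show "f \<in> hibi_ring"
    by (simp add: poly_mapping_sum_single)
qed

lemma hibi_canonical_module_eq:
  "hibi_canonical_module = (supported_on (canonical_exponents join_irreducibles) ::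
     ('a::{finite, lattice}, 'k::field) mpoly set)"
  unfolding hibi_canonical_module_def range_const_poly T_monomial_image[OF finite]
    span_over_supported_on by simp

section \<open>The minimal generating system\<close>

definition irreducible_exponents :: "'a::order set \<Rightarrow> ('a \<Rightarrow>\<^sub>0 nat) set" where
  "irreducible_exponents P = {e \<in> canonical_exponents P.
     \<forall>b\<in>ring_exponents P. \<forall>e'\<in>canonical_exponents P. e = b + e' \<longrightarrow> b = 0}"

text \<open>Nonzero ring exponents are split off until none is left; each one lowers the value at
  \<open>bot\<close>.\<close>

lemma canonical_exponent_decompose:
  fixes P :: "'a::order_bot set"
  assumes "bot \<in> P" "e \<in> canonical_exponents P"
  shows "\<exists>b\<in>ring_exponents P. \<exists>s\<in>irreducible_exponents P. e = b + s"
  using assms(2)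
proof (induction "Poly_Mapping.lookup e bot" arbitrary: e rule: less_induct)
  case less
  show ?case
  proof (cases "e \<in> irreducible_exponents P")
    case True
    then show ?thesis
      using zero_ring_exponents[of P] by (metis add_0)
  next
    case False
    then obtain b e' where b: "b \<in> ring_exponents P" "e' \<in> canonical_exponents P" "e = b + e'" "b \<noteq> 0"
      using less.prems by (auto simp: irreducible_exponents_def)
    have "Poly_Mapping.lookup e' bot < Poly_Mapping.lookup e bot"
      using lookup_bot_pos[OF assms(1) b(1,4)] by (simp add: b(3) lookup_add)
    then obtain b' s where "b' \<in> ring_exponents P" "s \<in> irreducible_exponents P" "e' = b' + s"
      using less.hyps b(2) by blast
    with b show ?thesis
      using add_ring_exponents[of b P b'] by (metis add.assoc)
  qed
qed

text \<open>Generation is \<open>canonical_exponent_decompose\<close>. For minimality, an omitted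
  \<open>s\<close> would have to be \<open>b + s'\<close> with \<open>s'\<close> retained;
  irreducibility gives \<open>b = 0\<close>, so \<open>s = s'\<close>.\<close>

lemma minimal_generating_system_irreducible:
  "minimal_generating_system hibi_ring hibi_canonical_module
     (monomial ` irreducible_exponents join_irreducibles ::
       ('a::{finite, distrib_lattice, bounded_lattice_bot}, 'k::field) mpoly set)"
proof -
  let ?P = "join_irreducibles :: 'a set"
  let ?R = "supported_on (ring_exponents ?P) :: ('a, 'k) mpoly set"
  let ?S = "irreducible_exponents ?P"
  have "{b + s | b s. b \<in> ring_exponents ?P \<and> s \<in> ?S} = canonical_exponents ?P"
  proof (intro subset_antisym subsetI)
    fix e assume "e \<in> canonical_exponents ?P"
    then show "e \<in> {b + s | b s. b \<in> ring_exponents ?P \<and> s \<in> ?S}"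
      using canonical_exponent_decompose[OF bot_join_irreducible] by blast
  next
    fix e assume "e \<in> {b + s | b s. b \<in> ring_exponents ?P \<and> s \<in> ?S}"
    then obtain b s where "e = b + s" "b \<in> ring_exponents ?P" "s \<in> canonical_exponents ?P"
      unfolding irreducible_exponents_def by blast
    then show "e \<in> canonical_exponents ?P"
      using add_canonical_exponents by blast
  qed
  then have "span_over ?R (monomial ` ?S) = supported_on (canonical_exponents ?P)"
    by (simp add: span_over_supported_on)
  moreover have "span_over ?R G \<noteq> supported_on (canonical_exponents ?P)"
    if G: "G \<subset> monomial ` ?S" for G
  proof
    assume span: "span_over ?R G = supported_on (canonical_exponents ?P)"
    obtain S' where S': "S' \<subseteq> ?S" "G = monomial ` S'"
      by (rule subset_imageE[OF psubset_imp_subset[OF G]])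
    obtain s where s: "s \<in> ?S" "monomial s \<notin> G"
      using psubset_imp_ex_mem[OF G] by auto
    then have "monomial s \<in> (supported_on (canonical_exponents ?P) :: ('a, 'k) mpoly set)"
      by (simp add: supported_on_def irreducible_exponents_def)
    then have "monomial s \<in> (supported_on {b + s | b s. b \<in> ring_exponents ?P \<and> s \<in> S'} ::
        ('a, 'k) mpoly set)"
      using span S'(2) by (simp add: span_over_supported_on)
    then obtain b s' where b: "b \<in> ring_exponents ?P" "s' \<in> S'" "s = b + s'"
      by (auto simp: supported_on_def)
    moreover have "s' \<in> canonical_exponents ?P"
      using b(2) S'(1) by (auto simp: irreducible_exponents_def)
    ultimately have "b = 0"
      using s(1) by (auto simp: irreducible_exponents_def)
    with b s(2) S'(2) show False by simp
  qed
  ultimately show ?thesis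
    unfolding minimal_generating_system_def hibi_ring_eq hibi_canonical_module_eq by blast
qed

section \<open>From rigid potentials to generators of every degree in the range\<close>

text \<open>For a splitting \<open>e = b + e'\<close> with \<open>b\<close> nonzero, the support of
  \<open>b\<close> would be a tight-closed set containing the bottom but not
  \<open>Pinf\<close>.\<close>

lemma rigid_potential_irreducible_exponent:
  fixes P :: "'a::order_bot set"
  assumes "finite P" "bot \<in> P" "rigid_potential P \<nu>"
  shows "exponent P (\<lambda>x. nat (\<nu> (Fin x))) \<in> irreducible_exponents P"
proof -
  define e where "e = exponent P (\<lambda>x. nat (\<nu> (Fin x)))"
  have strict: "\<nu> y < \<nu> x" if "x \<in> plus_poset P" "y \<in> plus_poset P" "x < y" for x y
    using that assms(3) by (auto simp: rigid_potential_def monotone_on_def)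
  have inf: "\<nu> Pinf = 0"
    using assms(3) by (simp add: rigid_potential_def)
  have pos: "0 < \<nu> (Fin x)" if "x \<in> P" for x
    using strict[of "Fin x" Pinf] that inf by (simp add: plus_poset_def)
  have look: "int (Poly_Mapping.lookup e x) = \<nu> (Fin x)" if "x \<in> P" for x
    using pos[OF that] that by (simp add: e_def lookup_exponent[OF assms(1)])
  have "Poly_Mapping.lookup e y < Poly_Mapping.lookup e x" if "x \<in> P" "y \<in> P" "x < y" for x y
    using look[OF that(1)] look[OF that(2)] strict[of "Fin x" "Fin y"] that
    by (simp add: plus_poset_def)
  moreover have "0 < Poly_Mapping.lookup e x" if "x \<in> P" for x
    using look[OF that] pos[OF that] by simp
  ultimately have "e \<in> canonical_exponents P"
    using keys_exponent[OF assms(1)]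
    by (simp add: canonical_exponents_def strict_reversing_maps_def e_def)
  moreover have "b = 0"
    if b: "b \<in> ring_exponents P" "e' \<in> canonical_exponents P" "e = b + e'" for b e'
  proof (rule ccontr)
    assume "b \<noteq> 0"
    define I where "I = Fin ` {x \<in> P. 0 < Poly_Mapping.lookup b x}"
    have sum: "\<nu> (Fin x) = int (Poly_Mapping.lookup b x) + int (Poly_Mapping.lookup e' x)"
      if "x \<in> P" for x
      using look[OF that] b(3) by (simp add: lookup_add)
    have e': "0 < Poly_Mapping.lookup e' x" if "x \<in> P" for x
      using b(2) that by (auto simp: canonical_exponents_def strict_reversing_maps_def)
    have "z \<in> I" if x: "Fin x \<in> I" and z: "z \<in> plus_poset P"
      "z \<le> Fin x \<or> Fin x < z \<and> \<nu> (Fin x) = \<nu> z + 1" for x z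
    proof -
      have xP: "x \<in> P" "0 < Poly_Mapping.lookup b x"
        using x by (auto simp: I_def)
      show ?thesis
      \<comment> \<open>A tight step to \<open>Pinf\<close> needs value 1, but \<open>b\<close> and
        \<open>e'\<close> are both positive at \<open>x\<close>. On a tight step up to
        \<open>w\<close> the sum drops by one and \<open>e'\<close> by at least one, so
        \<open>b\<close> does not drop.\<close>
      proof (cases "z = Pinf")
        case True
        then have "\<nu> (Fin x) = 1"
          using z(2) inf by auto
        with sum[OF xP(1)] e'[OF xP(1)] xP(2) show ?thesis by linarith
      next
        case False
        then obtain w where w: "z = Fin w" "w \<in> P"
          using z(1) by (auto simp: plus_poset_def)
        have "0 < Poly_Mapping.lookup b w"
        proof (cases "w \<le> x")
          case True
          then have "Poly_Mapping.lookup b x \<le> Poly_Mapping.lookup b w"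
            using b(1) xP(1) w(2) by (auto simp: ring_exponents_def)
          with xP(2) show ?thesis by simp
        next
          case False
          then have "x < w" "\<nu> (Fin x) = \<nu> (Fin w) + 1"
            using z(2) w(1) by auto
          moreover from this have "Poly_Mapping.lookup e' w < Poly_Mapping.lookup e' x"
            using b(2) xP(1) w(2) by (auto simp: canonical_exponents_def strict_reversing_maps_def)
          ultimately show ?thesis
            using sum[OF xP(1)] sum[OF w(2)] xP(2) by linarith
        qed
        with w show ?thesis by (simp add: I_def)
      qed
    qed
    moreover have "I \<subseteq> plus_poset P" "\<And>x. x \<in> I \<Longrightarrow> \<exists>w. x = Fin w"
      by (auto simp: I_def plus_poset_def)
    ultimately have "tight_closed P \<nu> I"
      unfolding tight_closed_def by metis
    moreover have "Fin bot \<in> I"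
      using lookup_bot_pos[OF assms(2) b(1) \<open>b \<noteq> 0\<close>] assms(2) by (simp add: I_def)
    ultimately have "Pinf \<in> I"
      using assms(3) unfolding rigid_potential_def by blast
    then show False by (auto simp: I_def)
  qed
  ultimately show ?thesis
    unfolding irreducible_exponents_def e_def[symmetric] by blast
qed

theorem theorem3p12:
  fixes P :: "'a::{finite, distrib_lattice, bounded_lattice_bot} set"
    and r d :: int
  assumes "P = join_irreducibles"
    and "r = poset_rank (plus_poset P)"
    and "r \<le> d" and "d \<le> r_max P"
  shows "\<exists>f :: ('a, 'k::field) mpoly. canonical_generator f \<and> hibi_homogeneous d f"
proof -
  have bot: "bot \<in> P"
    by (simp add: assms(1) bot_join_irreducible)
  obtain t y x where "condition_N P t y x" "r_max P = r_seq P t y x"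
    using r_max_attained[OF finite bot] .
  then obtain \<nu> where \<nu>: "rigid_potential P \<nu>" "d \<le> \<nu> (Fin bot)"
    using condition_N_rigid_potential[OF finite bot] assms(4) by (metis order_trans)
  \<comment> \<open>The shift is chosen to give the value \<open>max r d\<close> at the bottom,
    which is \<open>d\<close> because \<open>r \<le> d\<close>.\<close>
  define \<mu> where "\<mu> z = max (interval_rank P z Pinf) (\<nu> z - (\<nu> (Fin bot) - d))" for z
  have rigid: "rigid_potential P \<mu>"
    unfolding \<mu>_def using rigid_potential_lower[OF finite \<nu>(1)] \<nu>(2) by simp
  have "plus_interval P (Fin bot) Pinf = plus_poset P"
    by (auto simp: plus_interval_def plus_poset_def)
  then have \<mu>_bot: "\<mu> (Fin bot) = d"
    using assms(2,3) by (simp add: \<mu>_def)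
  have "0 \<le> interval_rank P (Fin bot) Pinf"
    using interval_rank_nonneg[OF finite, of "Fin bot" P Pinf] bot by (simp add: plus_poset_def)
  then have d: "0 \<le> d"
    using \<mu>_bot by (simp add: \<mu>_def)
  define e where "e = exponent P (\<lambda>x. nat (\<mu> (Fin x)))"
  have "e \<in> irreducible_exponents join_irreducibles"
    unfolding e_def using rigid_potential_irreducible_exponent[OF finite bot rigid] assms(1) by simp
  moreover have "monomial ` irreducible_exponents P \<subseteq> (range (T_monomial P) :: ('a, 'k) mpoly set)"
    unfolding irreducible_exponents_def
    using T_monomial_image[OF finite, of P, where 'k = 'k] by blast
  ultimately have "canonical_generator (monomial e :: ('a, 'k) mpoly)"
    unfolding canonical_generator_def using minimal_generating_system_irreducible assms(1) by blast
  moreover have "hibi_homogeneous d (monomial e :: ('a, 'k) mpoly)"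
    using bot \<mu>_bot d by (simp add: hibi_homogeneous_def e_def lookup_exponent)
  ultimately show ?thesis by blast
qed

end
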